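(* Let $\mathcal X=\{(X_\alpha,d_\alpha)\}_{\alpha\in I}$ be a family of metric spaces. Then \[ \operatorname{asdim}(\mathcal X)=\sup_{J}\operatorname{asdim}\big(\{(X_\alpha,d_\alpha)\}_{\alpha\in J}\big), \] where the supremum is over all countable subsets $J\subset I$.
   Context: A family of metric spaces $\{X_\alpha\}_\alpha$ has $\operatorname{asdim}\le n$ (uniformly) if for every $R>0$ there is $S>0$ such that every $X_\alpha$ has a cover $\mathcal U^\alpha$ by sets of diameter at most $S$, with multiplicity at most $n+1$ (any $n+2$ distinct members have empty intersection) and Lebesgue number at least $R$ (every non-empty subset of $X_\alpha$ of diameter at most $R$ lies in some member of $\mathcal U^\alpha$). The value $\operatorname{asdim}\in\{0,1,2,\dots\}\cup\{\infty\}$ is the least such $n$, or $\infty$ if there is none. *)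

theory Defs
  imports "HOL-Analysis.Analysis" "HOL-Library.Extended_Nat"
begin

text \<open>
  Diameter of a subset of a metric space. It takes values in \<^typ>\<open>ennreal\<close>, so that unbounded
  sets have diameter \<open>\<infinity>\<close>, and the empty set has diameter \<open>0\<close>.
\<close>

definition mdiam :: "'a metric \<Rightarrow> 'a set \<Rightarrow> ennreal" where
  "mdiam m A = (SUP x\<in>A. SUP y\<in>A. ennreal (mdist m x y))"

definition cover_of :: "'a metric \<Rightarrow> 'a set set \<Rightarrow> bool" where
  "cover_of m \<U> \<longleftrightarrow> (\<forall>U\<in>\<U>. U \<subseteq> mspace m) \<and> \<Union>\<U> = mspace m"

definition multiplicity_le :: "'a set set \<Rightarrow> nat \<Rightarrow> bool" where
  "multiplicity_le \<U> k \<longleftrightarrow> (\<forall>\<V>. \<V> \<subseteq> \<U> \<and> finite \<V> \<and> card \<V> = k + 1 \<longrightarrow> \<Inter>\<V> = {})"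

definition lebesgue_number_ge :: "'a metric \<Rightarrow> 'a set set \<Rightarrow> real \<Rightarrow> bool" where
  "lebesgue_number_ge m \<U> R \<longleftrightarrow>
    (\<forall>A. A \<noteq> {} \<and> A \<subseteq> mspace m \<and> mdiam m A \<le> ennreal R \<longrightarrow> (\<exists>U\<in>\<U>. A \<subseteq> U))"

text \<open>
  A family of metric spaces is given by an index set \<open>I\<close> and a map \<open>X\<close> from indices to
  metric spaces; the values of \<open>X\<close> outside \<open>I\<close> are irrelevant. The carriers are arbitrary,
  not necessarily disjoint subsets of a common ambient type, each with its own metric.
\<close>

definition asdim_le :: "'i set \<Rightarrow> ('i \<Rightarrow> 'a metric) \<Rightarrow> nat \<Rightarrow> bool" where
  "asdim_le I X n \<longleftrightarrow>
    (\<forall>R::real. R > 0 \<longrightarrow> (\<exists>S::real. S > 0 \<and> (\<forall>i\<in>I. \<exists>\<U>.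
        cover_of (X i) \<U> \<and>
        (\<forall>U\<in>\<U>. mdiam (X i) U \<le> ennreal S) \<and>
        multiplicity_le \<U> (n + 1) \<and>
        lebesgue_number_ge (X i) \<U> R)))"

definition asdim :: "'i set \<Rightarrow> ('i \<Rightarrow> 'a metric) \<Rightarrow> enat" where
  "asdim I X = (if \<exists>n. asdim_le I X n then enat (LEAST n. asdim_le I X n) else \<infinity>)"

end

theory Submission
  imports Defs
begin

text \<open>
  If \<open>asdim \<le> n\<close> fails for the whole family, there is a scale \<open>R\<close> such that for every natural
  number \<open>k\<close> some member of the family has no suitable cover by sets of diameter at most
  \<open>k + 1\<close>. Choosing one such member for each \<open>k\<close> gives a countable subfamily for which
  \<open>asdim \<le> n\<close> fails already. Hence both sides have the same upper bounds in \<open>\<nat>\<close>.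
\<close>

text \<open>The condition tests subfamilies of one exact size, so a larger bound needs an argument:
  among \<open>l + 1\<close> distinct members one finds \<open>k + 1\<close>, whose intersection is
  already empty.\<close>

lemma multiplicity_le_mono:
  assumes "multiplicity_le \<U> k" and "k \<le> l"
  shows "multiplicity_le \<U> l"
  unfolding multiplicity_le_def
proof (intro allI impI)
  fix \<V> assume \<V>: "\<V> \<subseteq> \<U> \<and> finite \<V> \<and> card \<V> = l + 1"
  then obtain \<W> where "\<W> \<subseteq> \<V>" "card \<W> = k + 1" "finite \<W>"
    using obtain_subset_with_card_n[of "k + 1" \<V>] assms(2) by auto
  with \<V> assms(1) have "\<Inter>\<W> = {}"
    unfolding multiplicity_le_def by blast
  with \<open>\<W> \<subseteq> \<V>\<close> show "\<Inter>\<V> = {}"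
    by blast
qed

text \<open>Isolates the conditions on a cover of one single space, so that the quantifiers over
  \<open>R\<close>, \<open>S\<close> and the index, whose order carries the uniformity, stand
  alone.\<close>

definition good_cover :: "nat \<Rightarrow> real \<Rightarrow> real \<Rightarrow> 'a metric \<Rightarrow> 'a set set \<Rightarrow> bool" where
  "good_cover n R S m \<U> \<longleftrightarrow> cover_of m \<U> \<and> (\<forall>U\<in>\<U>. mdiam m U \<le> ennreal S) \<and>
     multiplicity_le \<U> (n + 1) \<and> lebesgue_number_ge m \<U> R"

lemma asdim_le_iff_good_cover:
  "asdim_le I X n \<longleftrightarrow> (\<forall>R>0. \<exists>S>0. \<forall>i\<in>I. \<exists>\<U>. good_cover n R S (X i) \<U>)"
  by (simp only: asdim_le_def good_cover_def)

lemma good_cover_mono: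
  assumes "good_cover n R S m \<U>" and "n \<le> k" and "S \<le> T"
  shows "good_cover k R T m \<U>"
proof -
  have "mdiam m U \<le> ennreal T" if "U \<in> \<U>" for U
  proof -
    have "mdiam m U \<le> ennreal S"
      using assms(1) that by (simp add: good_cover_def)
    also have "\<dots> \<le> ennreal T"
      using assms(3) by (rule ennreal_leI)
    finally show ?thesis .
  qed
  moreover have "multiplicity_le \<U> (k + 1)"
    using assms(1,2) multiplicity_le_mono[of \<U> "n + 1" "k + 1"] by (simp add: good_cover_def)
  ultimately show ?thesis
    using assms(1) by (simp add: good_cover_def)
qed

lemma asdim_le_mono:
  assumes "asdim_le I X m" and "m \<le> n"
  shows "asdim_le I X n"
  unfolding asdim_le_iff_good_cover
proof (intro allI impI)
  fix R :: real assume "R > 0"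
  with assms(1) obtain S where S: "S > 0" "\<forall>i\<in>I. \<exists>\<U>. good_cover m R S (X i) \<U>"
    unfolding asdim_le_iff_good_cover by blast
  have "\<forall>i\<in>I. \<exists>\<U>. good_cover n R S (X i) \<U>"
    using S(2) good_cover_mono[OF _ assms(2) order_refl] by fast
  with S(1) show "\<exists>S>0. \<forall>i\<in>I. \<exists>\<U>. good_cover n R S (X i) \<U>"
    by auto
qed

lemma asdim_le_subset:
  assumes "asdim_le I X n" and "J \<subseteq> I"
  shows "asdim_le J X n"
  unfolding asdim_le_iff_good_cover
proof (intro allI impI)
  fix R :: real assume "R > 0"
  with assms(1) obtain S where "S > 0" "\<forall>i\<in>I. \<exists>\<U>. good_cover n R S (X i) \<U>"
    unfolding asdim_le_iff_good_cover by blast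
  with assms(2) show "\<exists>S>0. \<forall>i\<in>J. \<exists>\<U>. good_cover n R S (X i) \<U>"
    by auto
qed

text \<open>The values of \<open>n\<close> satisfying \<open>asdim_le\<close> are upward closed, so
  the \<open>LEAST\<close> is a threshold. This lets the supremum be handled through its finite
  upper bounds.\<close>

lemma asdim_le_enat_iff: "asdim I X \<le> enat n \<longleftrightarrow> asdim_le I X n"
proof
  assume *: "asdim I X \<le> enat n"
  then have ex: "\<exists>n. asdim_le I X n"
    by (auto simp: asdim_def split: if_splits)
  with * have "(LEAST n. asdim_le I X n) \<le> n"
    by (simp add: asdim_def)
  with LeastI_ex[OF ex] show "asdim_le I X n"
    by (rule asdim_le_mono)
next
  assume "asdim_le I X n"
  then show "asdim I X \<le> enat n"
    unfolding asdim_def using Least_le[of "asdim_le I X" n] by (simp add: exI[of _ n])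
qed

lemma asdim_le_iff_countable:
  "asdim_le I X n \<longleftrightarrow> (\<forall>J. J \<subseteq> I \<and> countable J \<longrightarrow> asdim_le J X n)"
proof
  assume "asdim_le I X n"
  then show "\<forall>J. J \<subseteq> I \<and> countable J \<longrightarrow> asdim_le J X n"
    using asdim_le_subset[of I X n] by simp
next
  assume countable: "\<forall>J. J \<subseteq> I \<and> countable J \<longrightarrow> asdim_le J X n"
  show "asdim_le I X n"
  proof (rule ccontr)
    assume "\<not> asdim_le I X n"
    then obtain R where R: "R > 0" "\<And>S. S > 0 \<Longrightarrow> \<exists>i\<in>I. \<nexists>\<U>. good_cover n R S (X i) \<U>"
      unfolding asdim_le_iff_good_cover by blast
    \<comment> \<open>The shift by 1 keeps the diameter bound positive at \<open>k = 0\<close>, as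
      the choice of \<open>R\<close> demands.\<close>
    have "\<exists>i\<in>I. \<nexists>\<U>. good_cover n R (real k + 1) (X i) \<U>" for k :: nat
      by (rule R(2)) simp
    then obtain i where i: "\<And>k::nat. i k \<in> I" "\<And>k. \<nexists>\<U>. good_cover n R (real k + 1) (X (i k)) \<U>"
      by metis
    have "asdim_le (range i) X n"
      by (rule countable[rule_format]) (use i(1) in auto)
    then obtain S where S: "\<And>k. \<exists>\<U>. good_cover n R S (X (i k)) \<U>"
      using R(1) unfolding asdim_le_iff_good_cover by blast
    \<comment> \<open>A single \<open>S\<close> serves all of \<open>range i\<close>, while the
      bounds defeated by the spaces \<open>X (i k)\<close> are unbounded in \<open>k\<close>; some
      \<open>k\<close> has its bound above \<open>S\<close>.\<close>
    obtain k where k: "S \<le> real k"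
      using real_arch_simple by blast
    obtain \<U> where "good_cover n R S (X (i k)) \<U>"
      using S by blast
    then have "good_cover n R (real k + 1) (X (i k)) \<U>"
      by (rule good_cover_mono) (use k in simp_all)
    with i(2) show False
      by blast
  qed
qed

theorem lemma2p2:
  fixes I :: "'i set" and X :: "'i \<Rightarrow> 'a metric"
  shows "asdim I X = (SUP J\<in>{J. J \<subseteq> I \<and> countable J}. asdim J X)"
proof -
  let ?s = "SUP J\<in>{J. J \<subseteq> I \<and> countable J}. asdim J X"
  have *: "asdim I X \<le> enat n \<longleftrightarrow> ?s \<le> enat n" for n
    unfolding SUP_le_iff asdim_le_enat_iff by (subst asdim_le_iff_countable) simp
  show ?thesis
  \<comment> \<open>For each inequality, a finite right-hand side is an upper bound of itself, and
    \<open>*\<close> transfers it to the left-hand side; an infinite one is trivial.\<close>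
  proof (rule antisym)
    show "asdim I X \<le> ?s"
    proof (cases ?s)
      case (enat n)
      with *[of n] show ?thesis by simp
    qed simp
    show "?s \<le> asdim I X"
    proof (cases "asdim I X")
      case (enat n)
      with *[of n] show ?thesis by simp
    qed simp
  qed
qed

end
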